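(* Let $m=n-1$. The map $\Phi_m$ from the set of Schröder trees with $n$ leaves to the set of words for $\rho_{n-1}^n$ in $M_{n-1}$ is bijective.
   Context: Monoid: for $m\ge 1$, $M_m$ is the monoid with presentation $\langle \rho_1,\dots,\rho_m \mid \rho_1\rho_m\rho_i=\rho_{i+1}\rho_m \text{ for all } 1\le i\le m-1\rangle$; $M_0$ is the trivial monoid. A word for $x\in M_m$ is a finite sequence of letters in $\{\rho_1,\dots,\rho_m\}$ whose product in $M_m$ is $x$. Convention: $\rho_0=e$ (identity; as a letter it is deleted). Trees: a rooted plane tree is either the empty tree (a single leaf, no inner vertex) or a tuple $(r,(T_1,\dots,T_k))$ with $r$ the root and $T_1,\dots,T_k$ an ordered (left to right) list of rooted plane trees, whose roots are the children of $r$. A Schröder tree is a rooted plane tree in which every inner vertex has at least two children. In what follows, leaves count as vertices. Post-order traversal: visit recursively $T_1$, then $T_2$, ..., then $T_k$, and finally the root $r$; the empty tree is visited by visiting its leaf. Labelling: let $T$ be a Schröder tree with $n$ leaves and let $m\ge n-1$. Label the vertices one after the other in post-order: (1) if $v$ is the leftmost child of $w$, where $w$ is the root of the subtree $(w,(T_1,\dots,T_k))$ and $v$ is the root of $T_1$, then $\lambda(v)$ is the total number of leaves of $T_2,\dots,T_k$; (2) if $v$ is not the leftmost child of a vertex, then $\lambda(v)=m-\sum_{w\in LD(v)}\lambda(w)$, where $LD(v)$ is the set of leftmost descendants of $v$: the leftmost child of $v$, its leftmost child, and so on (empty if $v$ is a leaf). All labels are positive except that the root may have label $0$. $\Phi_m(T)$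 is the word obtained by reading the labels of $T$ in post-order and replacing each label $i$ by $\rho_i$. *)

theory Defs
  imports "HOL-Algebra.Group"
begin

section \<open>The monoids\<close>

text \<open>
  Words in the generators are lists over \<open>{1..m}\<close>; the letter \<open>i\<close> stands for \<open>\<rho>\<^sub>i\<close>.
  \<open>pres_cong m\<close> is the congruence on the free monoid generated by the defining relations
  \<open>\<rho>\<^sub>1 \<rho>\<^sub>m \<rho>\<^sub>i = \<rho>\<^bsub>i+1\<^esub> \<rho>\<^sub>m\<close>. For \<open>m = 0\<close> the only word is the empty one, so the quotient is trivial.
\<close>

inductive_set pres_cong :: "nat \<Rightarrow> (nat list \<times> nat list) set" for m :: nat where
  rel: "1 \<le> i \<Longrightarrow> i + 1 \<le> m \<Longrightarrow> ([1, m, i], [i + 1, m]) \<in> pres_cong m"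
| refl: "u \<in> lists {1..m} \<Longrightarrow> (u, u) \<in> pres_cong m"
| sym: "(u, v) \<in> pres_cong m \<Longrightarrow> (v, u) \<in> pres_cong m"
| trans: "(u, v) \<in> pres_cong m \<Longrightarrow> (v, w) \<in> pres_cong m \<Longrightarrow> (u, w) \<in> pres_cong m"
| append: "(u, u') \<in> pres_cong m \<Longrightarrow> (v, v') \<in> pres_cong m \<Longrightarrow> (u @ v, u' @ v') \<in> pres_cong m"

definition rho_monoid :: "nat \<Rightarrow> nat list set monoid" where
  "rho_monoid m = \<lparr>carrier = lists {1..m} // pres_cong m,
                  mult = (\<lambda>A B. \<Union>a\<in>A. \<Union>b\<in>B. pres_cong m `` {a @ b}),
                  one = pres_cong m `` {[]}\<rparr>"

definition rho :: "nat \<Rightarrow> nat \<Rightarrow> nat list set" where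
  "rho m i = (if i = 0 then \<one>\<^bsub>rho_monoid m\<^esub> else pres_cong m `` {[i]})"

definition word_prod :: "nat \<Rightarrow> nat list \<Rightarrow> nat list set" where
  "word_prod m w = foldr (\<lambda>i x. rho m i \<otimes>\<^bsub>rho_monoid m\<^esub> x) w \<one>\<^bsub>rho_monoid m\<^esub>"

definition words_for :: "nat \<Rightarrow> nat list set \<Rightarrow> nat list set" where
  "words_for m x = {w \<in> lists {1..m}. word_prod m w = x}"

lemma pres_cong_in_lists:
  "(u, v) \<in> pres_cong m \<Longrightarrow> u \<in> lists {1..m} \<and> v \<in> lists {1..m}"
  by (induction rule: pres_cong.induct) auto

lemma equiv_pres_cong: "equiv (lists {1..m}) (pres_cong m)"
proof (rule equivI)
  show "pres_cong m \<subseteq> lists {1..m} \<times> lists {1..m}"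
    by (auto dest: pres_cong_in_lists simp del: in_lists_conv_set)
  show "refl_on (lists {1..m}) (pres_cong m)"
    by (rule refl_onI) (rule pres_cong.refl)
  show "sym (pres_cong m)"
    by (rule symI) (rule pres_cong.sym)
  show "trans (pres_cong m)"
    by (rule transI) (rule pres_cong.trans)
qed

lemma mult_class_rho_monoid:
  assumes "u \<in> lists {1..m}" "v \<in> lists {1..m}"
  shows "(pres_cong m `` {u}) \<otimes>\<^bsub>rho_monoid m\<^esub> (pres_cong m `` {v}) = pres_cong m `` {u @ v}"
proof -
  have "congruent2 (pres_cong m) (pres_cong m) (\<lambda>a b. pres_cong m `` {a @ b})"
    by (rule congruent2I') (metis equiv_class_eq equiv_pres_cong pres_cong.append)
  from UN_equiv_class2[OF equiv_pres_cong equiv_pres_cong this assms]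
  show ?thesis by (simp add: rho_monoid_def)
qed

lemma monoid_rho_monoid: "monoid (rho_monoid m)"
proof (rule monoidI)
  have carrier: "x \<in> carrier (rho_monoid m) \<longleftrightarrow> (\<exists>u\<in>lists {1..m}. x = pres_cong m `` {u})" for x
    by (auto simp: rho_monoid_def quotient_def)
  have one: "\<one>\<^bsub>rho_monoid m\<^esub> = pres_cong m `` {[]}"
    by (simp add: rho_monoid_def)
  show "x \<otimes>\<^bsub>rho_monoid m\<^esub> y \<in> carrier (rho_monoid m)" if "x \<in> carrier (rho_monoid m)" "y \<in> carrier (rho_monoid m)" for x y
    using that unfolding carrier by (metis append_in_lists_conv mult_class_rho_monoid)
  show "\<one>\<^bsub>rho_monoid m\<^esub> \<in> carrier (rho_monoid m)"
    unfolding carrier one by blast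
  show "x \<otimes>\<^bsub>rho_monoid m\<^esub> y \<otimes>\<^bsub>rho_monoid m\<^esub> z = x \<otimes>\<^bsub>rho_monoid m\<^esub> (y \<otimes>\<^bsub>rho_monoid m\<^esub> z)"
    if "x \<in> carrier (rho_monoid m)" "y \<in> carrier (rho_monoid m)" "z \<in> carrier (rho_monoid m)" for x y z
    using that unfolding carrier by (metis append.assoc append_in_lists_conv mult_class_rho_monoid)
  show "\<one>\<^bsub>rho_monoid m\<^esub> \<otimes>\<^bsub>rho_monoid m\<^esub> x = x" if "x \<in> carrier (rho_monoid m)" for x
    using that unfolding carrier one by (metis append_Nil lists.Nil mult_class_rho_monoid)
  show "x \<otimes>\<^bsub>rho_monoid m\<^esub> \<one>\<^bsub>rho_monoid m\<^esub> = x" if "x \<in> carrier (rho_monoid m)" for x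
    using that unfolding carrier one by (metis append_Nil2 lists.Nil mult_class_rho_monoid)
qed

section \<open>Schroeder trees\<close>

text \<open>
  \<open>Leaf\<close> is the empty tree, \<open>Node [T\<^sub>1, \<dots>, T\<^sub>k]\<close> is \<open>(r, (T\<^sub>1, \<dots>, T\<^sub>k))\<close>; the name of the root
  is immaterial. The tree \<open>Node []\<close> is not a Schroeder tree.
\<close>

datatype ptree = Leaf | Node "ptree list"

fun children :: "ptree \<Rightarrow> ptree list" where
  "children Leaf = []"
| "children (Node ts) = ts"

fun schroeder :: "ptree \<Rightarrow> bool" where
  "schroeder Leaf \<longleftrightarrow> True"
| "schroeder (Node ts) \<longleftrightarrow> length ts \<ge> 2 \<and> (\<forall>t\<in>set ts. schroeder t)"

fun leaves :: "ptree \<Rightarrow> nat" where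
  "leaves Leaf = 1"
| "leaves (Node ts) = (\<Sum>t\<leftarrow>ts. leaves t)"

definition schroeder_trees :: "nat \<Rightarrow> ptree set" where
  "schroeder_trees n = {T. schroeder T \<and> leaves T = n}"

text \<open>
  A vertex is addressed by the path from the root to it, i.e. by a list of child positions
  counted from 0: \<open>[]\<close> is the root and \<open>v @ [i]\<close> is the child number \<open>i\<close> of \<open>v\<close>.
\<close>

fun postorder :: "ptree \<Rightarrow> nat list list" where
  "postorder Leaf = [[]]"
| "postorder (Node ts) =
     concat (map (\<lambda>(i, vs). map ((#) i) vs) (enumerate 0 (map postorder ts))) @ [[]]"

definition vertices :: "ptree \<Rightarrow> nat list set" where
  "vertices T = set (postorder T)"

text \<open>The subtree rooted at \<open>v\<close>; only meaningful if \<open>v \<in> vertices T\<close>.\<close>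

fun subtree :: "ptree \<Rightarrow> nat list \<Rightarrow> ptree" where
  "subtree T [] = T"
| "subtree T (i # v) = subtree (children T ! i) v"

definition leftmost_child :: "nat list \<Rightarrow> bool" where
  "leftmost_child v \<longleftrightarrow> (\<exists>w. v = w @ [0])"

definition LD :: "ptree \<Rightarrow> nat list \<Rightarrow> nat list set" where
  "LD T v = {w \<in> vertices T. \<exists>k\<ge>1. w = v @ replicate k 0}"

text \<open>
  If \<open>v\<close> is a leftmost child, its parent is \<open>butlast v\<close>. The subtraction on \<open>nat\<close> is not truncated
  for the parameters considered: the labels of \<open>LD T v\<close> add up to the number of leaves of the
  subtree at \<open>v\<close> minus 1, which is at most \<open>leaves T - 1 \<le> m\<close>.
\<close>

function label :: "nat \<Rightarrow> ptree \<Rightarrow> nat list \<Rightarrow> nat" where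
  "label m T v =
     (if leftmost_child v then (\<Sum>t\<leftarrow>tl (children (subtree T (butlast v))). leaves t)
      else m - (\<Sum>w\<in>LD T v. label m T w))"
  by auto
termination
proof (relation "measure (\<lambda>(m, T, v). if leftmost_child v then 0 else 1)", goal_cases)
  case 1
  show ?case by simp
next
  case (2 m T v w)
  then obtain k where "k \<ge> 1" "w = v @ replicate k 0"
    by (auto simp: LD_def)
  then have "leftmost_child w"
    by (cases k) (auto simp: leftmost_child_def replicate_append_same[symmetric])
  with 2 show ?case by simp
qed

declare label.simps [simp del]

text \<open>The letter \<open>\<rho>\<^sub>0\<close> denotes the identity and is deleted.\<close>

definition Phi :: "nat \<Rightarrow> ptree \<Rightarrow> nat list" where
  "Phi m T = filter (\<lambda>i. i \<noteq> 0) (map (label m T) (postorder T))"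

end

theory Submission
  imports Defs
begin

text \<open>
  Put \<open>x = \<rho>\<^sub>1 \<rho>\<^sub>m\<close> and \<open>y = \<rho>\<^sub>m\<close>. In the enveloping group the relations say \<open>\<rho>\<^sub>i = x\<^sup>i y\<^sup>-\<^sup>i\<close> and
  \<open>x\<^sup>m = y\<^sup>m\<^sup>+\<^sup>1\<close>. Without its root letter, the word of a tree with \<open>l\<close> leaves evaluates to \<open>x\<^sup>l\<^sup>-\<^sup>1\<close>, and
  a non-leftmost subtree with \<open>l\<close> leaves, including its root letter, evaluates to \<open>y\<^sup>l\<close>; hence
  \<open>\<Phi>\<^sub>m(T)\<close> is a word for \<open>x\<^sup>m = y\<^sup>m\<^sup>+\<^sup>1\<close>. Conversely, a prefix of such a word evaluates to a product
  of factors \<open>x\<^sup>a\<^sup>-\<^sup>1 y\<^sup>-\<^sup>b\<close>, one for every vertex whose children are being read (\<open>a\<close> is the total number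
  of its leaves and \<open>b\<close> the number of those not yet read), followed by \<open>x\<^sup>l\<^sup>-\<^sup>1\<close> for the last complete
  subtree, with \<open>l\<close> leaves. Multiplication by a letter transforms this stack deterministically and
  compatibly with the relations, so every word for \<open>x\<^sup>m\<close> leads to the same final stack as \<open>x\<^sup>m\<close> itself.
  The same automaton, storing trees instead of numbers of leaves, is a parser that inverts \<open>\<Phi>\<^sub>m\<close>.
\<close>

section \<open>Words of trees\<close>

abbreviation sum_leaves :: "ptree list \<Rightarrow> nat" where
  "sum_leaves ts \<equiv> (\<Sum>t\<leftarrow>ts. leaves t)"

text \<open>The labels of all vertices except the root, in post-order.\<close>

fun body :: "nat \<Rightarrow> ptree \<Rightarrow> nat list" where
  "body m Leaf = []"
| "body m (Node []) = []"
| "body m (Node (t # ts)) =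
     body m t @ [sum_leaves ts] @ concat (map (\<lambda>u. body m u @ [Suc m - leaves u]) ts)"

lemma leaves_pos: "schroeder t \<Longrightarrow> 1 \<le> leaves t"
proof (induction t rule: schroeder.induct)
  case (2 ts)
  then obtain u us where "ts = u # us" by (cases ts) auto
  then have "leaves u \<le> leaves (Node ts)" by simp
  moreover have "1 \<le> leaves u" using 2 \<open>ts = u # us\<close> by simp
  ultimately show ?case by linarith
qed simp

lemma schroeder_NodeE:
  assumes "schroeder (Node ts)"
  obtains u us where "ts = u # us" "us \<noteq> []" "schroeder u" "\<And>t. t \<in> set us \<Longrightarrow> schroeder t"
proof -
  from assms obtain u us where "ts = u # us" by (cases ts) auto
  with assms that[of u us] show ?thesis by (cases us) auto
qed

lemma sum_leaves_pos: "ts \<noteq> [] \<Longrightarrow> (\<And>t. t \<in> set ts \<Longrightarrow> schroeder t) \<Longrightarrow> 1 \<le> sum_leaves ts"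
  using leaves_pos by (cases ts) fastforce+

lemma leaves_le_sum_leaves: "t \<in> set ts \<Longrightarrow> leaves t \<le> sum_leaves ts"
  by (simp add: member_le_sum_list)

lemma schroeder_induct [consumes 1, case_names Leaf Node]:
  assumes "schroeder t"
    and "P Leaf"
    and "\<And>u us. us \<noteq> [] \<Longrightarrow> schroeder u \<Longrightarrow> (\<And>t. t \<in> set us \<Longrightarrow> schroeder t) \<Longrightarrow>
           P u \<Longrightarrow> (\<And>t. t \<in> set us \<Longrightarrow> P t) \<Longrightarrow> P (Node (u # us))"
  shows "P t"
  using assms(1)
proof (induction t)
  case Leaf
  show ?case by (rule assms(2))
next
  case (Node ts)
  from Node.prems show ?case
    by (rule schroeder_NodeE) (use Node.IH assms(3) in auto)
qed

section \<open>Paths to vertices and labels along leftmost chains\<close>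

lemma Nil_in_vertices: "[] \<in> vertices T"
  by (cases T) (auto simp: vertices_def)

lemma Cons_in_vertices:
  "i # v \<in> vertices T \<longleftrightarrow> i < length (children T) \<and> v \<in> vertices (children T ! i)"
  by (cases T) (force simp: vertices_def in_set_enumerate_eq)+

lemma append_in_vertices:
  "p @ v \<in> vertices T \<longleftrightarrow> p \<in> vertices T \<and> v \<in> vertices (subtree T p)"
  by (induction p arbitrary: T) (auto simp: Cons_in_vertices Nil_in_vertices)

lemma subtree_append: "subtree T (p @ v) = subtree (subtree T p) v"
  by (induction p arbitrary: T) auto

lemma schroeder_subtree: "schroeder T \<Longrightarrow> p \<in> vertices T \<Longrightarrow> schroeder (subtree T p)"
proof (induction p arbitrary: T)
  case (Cons i p)
  then show ?case by (cases T) (auto simp: Cons_in_vertices)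
qed simp

lemma label_leftmost: "label m T (p @ [0]) = sum_leaves (tl (children (subtree T p)))"
  by (simp add: label.simps leftmost_child_def)

lemma finite_LD: "finite (LD T v)"
  by (rule finite_subset[of _ "vertices T"]) (auto simp: LD_def vertices_def)

lemma LD_Leaf:
  assumes "subtree T p = Leaf"
  shows "LD T p = {}"
proof -
  have "p @ replicate k 0 \<notin> vertices T" if "k \<ge> 1" for k
    using that assms by (cases k) (auto simp: append_in_vertices Cons_in_vertices)
  then show ?thesis by (auto simp: LD_def)
qed

lemma LD_Node:
  assumes "p \<in> vertices T" "subtree T p = Node (u # us)"
  shows "LD T p = insert (p @ [0]) (LD T (p @ [0]))"
proof -
  have in_T: "p @ [0] \<in> vertices T"
    using assms by (simp add: append_in_vertices Cons_in_vertices Nil_in_vertices)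
  have "(\<exists>k\<ge>1. w = p @ replicate k 0) \<longleftrightarrow> w = p @ [0] \<or> (\<exists>k\<ge>1. w = (p @ [0]) @ replicate k 0)" for w
  proof
    assume "\<exists>k\<ge>1. w = p @ replicate k 0"
    then obtain k where k: "k \<ge> 1" "w = p @ replicate k 0" by blast
    then obtain j where "k = Suc j" by (cases k) auto
    with k show "w = p @ [0] \<or> (\<exists>k\<ge>1. w = (p @ [0]) @ replicate k 0)"
      by (cases j) auto
  next
    assume "w = p @ [0] \<or> (\<exists>k\<ge>1. w = (p @ [0]) @ replicate k 0)"
    then show "\<exists>k\<ge>1. w = p @ replicate k 0"
    proof
      assume "w = p @ [0]"
      then show ?thesis by (intro exI[of _ 1]) simp
    next
      assume "\<exists>k\<ge>1. w = (p @ [0]) @ replicate k 0"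
      then obtain k where "w = (p @ [0]) @ replicate k 0" by blast
      then show ?thesis by (intro exI[of _ "Suc k"]) simp
    qed
  qed
  with in_T show ?thesis by (auto simp: LD_def)
qed

text \<open>The sum telescopes: each leftmost child contributes the leaves below its parent minus
  those below itself, and the chain ends at a leaf.\<close>

lemma sum_label_LD:
  assumes "schroeder (subtree T p)" "p \<in> vertices T"
  shows "(\<Sum>w\<in>LD T p. label m T w) = leaves (subtree T p) - 1"
proof -
  have "schroeder t \<Longrightarrow> subtree T p = t \<Longrightarrow> p \<in> vertices T \<Longrightarrow>
      (\<Sum>w\<in>LD T p. label m T w) = leaves t - 1" for t
  proof (induction t arbitrary: p rule: schroeder_induct)
    case Leaf
    then show ?case by (simp add: LD_Leaf)
  next
    case (Node u us)
    have sub: "subtree T (p @ [0]) = u" "p @ [0] \<in> vertices T"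
      using Node.prems by (simp_all add: subtree_append append_in_vertices Cons_in_vertices Nil_in_vertices)
    have "p @ [0] \<notin> LD T (p @ [0])" by (auto simp: LD_def)
    then have "(\<Sum>w\<in>LD T p. label m T w) = sum_leaves us + (leaves u - 1)"
      using Node.IH(1)[OF sub] Node.prems by (simp add: LD_Node finite_LD label_leftmost)
    with leaves_pos[OF Node.hyps(2)] show ?case by simp
  qed
  from this[OF assms(1) HOL.refl assms(2)] show ?thesis .
qed

lemma label_not_leftmost:
  assumes "schroeder T" "p \<in> vertices T" "\<not> leftmost_child p"
  shows "label m T p = Suc m - leaves (subtree T p)"
  using assms sum_label_LD[OF schroeder_subtree[OF assms(1,2)] assms(2), of m]
    leaves_pos[OF schroeder_subtree[OF assms(1,2)]]
  by (simp add: label.simps[of m T p])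

lemma postorder_Node:
  "postorder (Node ts) = concat (map (\<lambda>i. map ((#) i) (postorder (ts ! i))) [0..<length ts]) @ [[]]"
proof -
  have "map (\<lambda>(i, vs). map ((#) i) vs) (enumerate 0 (map postorder ts)) =
      map (\<lambda>i. map ((#) i) (postorder (ts ! i))) [0..<length ts]"
    by (rule nth_equalityI) (auto simp: nth_enumerate_eq)
  then show ?thesis by simp
qed

text \<open>The root letter stays separate because it depends on the position of \<open>p\<close>;
  the other letters depend on the subtree alone.\<close>

lemma map_label_postorder:
  assumes "schroeder T" "p \<in> vertices T"
  shows "map (\<lambda>v. label m T (p @ v)) (postorder (subtree T p)) =
    body m (subtree T p) @ [label m T p]"
proof -
  have "schroeder t \<Longrightarrow> subtree T p = t \<Longrightarrow> p \<in> vertices T \<Longrightarrow>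
      map (\<lambda>v. label m T (p @ v)) (postorder t) = body m t @ [label m T p]" for t
  proof (induction t arbitrary: p rule: schroeder_induct)
    case Leaf
    then show ?case by simp
  next
    case (Node u us)
    let ?ts = "u # us"
    let ?word = "\<lambda>i. map (\<lambda>v. label m T (p @ i # v)) (postorder (?ts ! i))"
    have sub: "subtree T (p @ [i]) = ?ts ! i" "p @ [i] \<in> vertices T" if "i < length ?ts" for i
      using that Node.prems
      by (simp_all add: subtree_append append_in_vertices Cons_in_vertices Nil_in_vertices)
    have first: "?word 0 = body m u @ [sum_leaves us]"
      using Node.IH(1)[of "p @ [0]"] sub[of 0] Node.prems by (simp add: label_leftmost)
    have others: "?word (Suc i) = body m (us ! i) @ [Suc m - leaves (us ! i)]" if "i < length us" for i
    proof -
      have "\<not> leftmost_child (p @ [Suc i])" by (simp add: leftmost_child_def)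
      with label_not_leftmost[OF assms(1), of "p @ [Suc i]" m]
      show ?thesis
        using Node.IH(2)[of "us ! i" "p @ [Suc i]"] sub[of "Suc i"] that by simp
    qed
    have "map (\<lambda>v. label m T (p @ v)) (postorder (Node ?ts)) =
        concat (map ?word [0..<length ?ts]) @ [label m T p]"
      by (simp add: postorder_Node map_concat comp_def del: postorder.simps upt_Suc)
    also have "map ?word [0..<length ?ts] = ?word 0 # map (\<lambda>i. ?word (Suc i)) [0..<length us]"
      by (simp add: upt_conv_Cons map_Suc_upt[symmetric] comp_def del: upt_Suc)
    also have "map (\<lambda>i. ?word (Suc i)) [0..<length us] =
        map (\<lambda>t. body m t @ [Suc m - leaves t]) us"
      by (rule nth_equalityI) (use others in simp_all)
    finally show ?case unfolding first by (simp del: postorder.simps)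
  qed
  from this[OF schroeder_subtree[OF assms] HOL.refl assms(2)] show ?thesis .
qed

section \<open>Evaluation of the words of trees\<close>

definition xpow :: "nat \<Rightarrow> nat \<Rightarrow> nat list" where
  "xpow m k = concat (replicate k [1, m])"

lemma xpow_0 [simp]: "xpow m 0 = []"
  and xpow_Suc: "xpow m (Suc k) = [1, m] @ xpow m k"
  and xpow_add: "xpow m (j + k) = xpow m j @ xpow m k"
  by (simp_all add: xpow_def replicate_add)

lemma xpow_in_lists: "1 \<le> m \<Longrightarrow> xpow m k \<in> lists {1..m}"
  by (induction k) (auto simp: xpow_Suc)

text \<open>Each factor x in front raises the letter by one through a defining relation and leaves
  an \<open>m\<close> right after it.\<close>

lemma xpow_shift:
  assumes "1 \<le> i" "i + k \<le> m"
  shows "(xpow m k @ [i], [i + k] @ replicate k m) \<in> pres_cong m"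
  using assms(2)
proof (induction k)
  case 0
  with assms(1) show ?case by (auto intro: pres_cong.refl)
next
  case (Suc k)
  have "([1, m] @ (xpow m k @ [i]), [1, m] @ ([i + k] @ replicate k m)) \<in> pres_cong m"
    using Suc by (intro pres_cong.append[of "[1, m]"] pres_cong.refl) auto
  moreover have "([1, m, i + k] @ replicate k m, [i + k + 1, m] @ replicate k m) \<in> pres_cong m"
    using assms(1) Suc.prems by (intro pres_cong.append pres_cong.rel pres_cong.refl) auto
  ultimately have "([1, m] @ (xpow m k @ [i]), [i + k + 1, m] @ replicate k m) \<in> pres_cong m"
    by (auto intro: pres_cong.trans)
  then show ?case by (simp add: xpow_Suc)
qed

text \<open>The identity for the letter \<open>k\<close> in the enveloping group, with the inverse
  of y cleared; \<open>k = m\<close> gives y^(m+1) = x^m.\<close>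

lemma letter_xpow:
  assumes "1 \<le> k" "k \<le> m"
  shows "([k] @ replicate k m, xpow m k) \<in> pres_cong m"
  using assms
proof (induction k rule: dec_induct)
  case base
  then show ?case by (auto simp: xpow_def intro: pres_cong.refl)
next
  case (step k)
  have "([k + 1, m] @ replicate k m, [1, m, k] @ replicate k m) \<in> pres_cong m"
    using step by (intro pres_cong.append pres_cong.sym[OF pres_cong.rel] pres_cong.refl) auto
  moreover have "([1, m] @ ([k] @ replicate k m), [1, m] @ xpow m k) \<in> pres_cong m"
    using step by (intro pres_cong.append pres_cong.refl) auto
  ultimately have "([k + 1, m] @ replicate k m, [1, m] @ xpow m k) \<in> pres_cong m"
    by (auto intro: pres_cong.trans)
  then show ?case by (simp add: xpow_Suc)
qed

text \<open>With l leaves, x^(l-1) lifts the root letter m+1-l exactly to m, which leaves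
  y^l.\<close>

lemma body_root_cong:
  assumes "(body m t, xpow m (leaves t - 1)) \<in> pres_cong m" "1 \<le> leaves t" "leaves t \<le> m"
  shows "(body m t @ [Suc m - leaves t], replicate (leaves t) m) \<in> pres_cong m"
proof -
  have "(body m t @ [Suc m - leaves t], xpow m (leaves t - 1) @ [Suc m - leaves t]) \<in> pres_cong m"
    using assms by (intro pres_cong.append pres_cong.refl) auto
  also have "(xpow m (leaves t - 1) @ [Suc m - leaves t], [m] @ replicate (leaves t - 1) m)
      \<in> pres_cong m"
    using xpow_shift[of "Suc m - leaves t" "leaves t - 1" m] assms by simp
  also (pres_cong.trans) have "[m] @ replicate (leaves t - 1) m = replicate (leaves t) m"
    using assms(2) by (cases "leaves t") auto
  finally show ?thesis .
qed

text \<open>The non-leftmost subtrees give y^s with s = \<open>sum_leaves us\<close>; the letter s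
  before them turns this into x^s, to which the leftmost subtree adds
  x^(\<open>leaves u - 1\<close>).\<close>

lemma body_cong:
  assumes "schroeder t" "leaves t \<le> Suc m"
  shows "(body m t, xpow m (leaves t - 1)) \<in> pres_cong m"
  using assms
proof (induction t rule: schroeder_induct)
  case Leaf
  show ?case by (auto intro: pres_cong.refl)
next
  case (Node u us)
  let ?rest = "\<lambda>us. concat (map (\<lambda>t. body m t @ [Suc m - leaves t]) us)"
  have u: "1 \<le> leaves u" using Node.hyps(2) by (rule leaves_pos)
  have us: "1 \<le> sum_leaves us" using Node.hyps(1,3) by (rule sum_leaves_pos)
  have le: "leaves u + sum_leaves us \<le> Suc m" using Node.prems by simp
  have "(?rest us, replicate (sum_leaves us) m) \<in> pres_cong m"
  proof -
    have "(\<And>t. t \<in> set ts \<Longrightarrow> t \<in> set us) \<Longrightarrow> (?rest ts, replicate (sum_leaves ts) m) \<in> pres_cong m" for ts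
    proof (induction ts)
      case Nil
      show ?case by (auto intro: pres_cong.refl)
    next
      case (Cons t ts)
      have t: "t \<in> set us" using Cons.prems by simp
      have "leaves t \<le> m" using leaves_le_sum_leaves[OF t] u le by simp
      moreover have "(body m t, xpow m (leaves t - 1)) \<in> pres_cong m"
        using Node.IH(2)[OF t] \<open>leaves t \<le> m\<close> by simp
      ultimately have "(body m t @ [Suc m - leaves t], replicate (leaves t) m) \<in> pres_cong m"
        using leaves_pos[OF Node.hyps(3)[OF t]] by (intro body_root_cong)
      from pres_cong.append[OF this Cons.IH] Cons.prems show ?case
        by (simp add: replicate_add)
    qed
    from this[of us] show ?thesis by simp
  qed
  then have "([sum_leaves us] @ ?rest us, [sum_leaves us] @ replicate (sum_leaves us) m) \<in> pres_cong m"
    using u us le by (intro pres_cong.append pres_cong.refl) auto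
  also have "([sum_leaves us] @ replicate (sum_leaves us) m, xpow m (sum_leaves us)) \<in> pres_cong m"
    using u us le by (intro letter_xpow) auto
  finally (pres_cong.trans)
  have "([sum_leaves us] @ ?rest us, xpow m (sum_leaves us)) \<in> pres_cong m" .
  moreover have "(body m u, xpow m (leaves u - 1)) \<in> pres_cong m"
    using Node.IH(1) le by simp
  ultimately have "(body m u @ [sum_leaves us] @ ?rest us, xpow m (leaves u - 1) @ xpow m (sum_leaves us)) \<in> pres_cong m"
    by (intro pres_cong.append)
  with u show ?case by (simp flip: xpow_add)
qed

lemma Phi_eq_body:
  assumes "schroeder T" "leaves T = Suc m"
  shows "Phi m T = body m T"
proof -
  have "map (label m T) (postorder T) = body m T @ [label m T []]"
    using map_label_postorder[OF assms(1) Nil_in_vertices] by simp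
  moreover have "label m T [] = 0"
    using label_not_leftmost[OF assms(1) Nil_in_vertices, of m] assms(2)
    by (simp add: leftmost_child_def)
  \<comment> \<open>Positivity of the remaining letters is free: \<open>pres_cong m\<close> relates
    only words over \<open>{1..m}\<close>.\<close>
  moreover have "body m T \<in> lists {1..m}"
    using body_cong[OF assms(1), of m] assms(2) by (blast dest: pres_cong_in_lists intro: eq_imp_le)
  then have "filter (\<lambda>i. i \<noteq> 0) (body m T) = body m T"
    by (intro filter_True) auto
  ultimately show ?thesis by (simp add: Phi_def)
qed

section \<open>The stack automaton\<close>

fun run :: "('i \<Rightarrow> 's \<Rightarrow> 's option) \<Rightarrow> 'i list \<Rightarrow> 's \<Rightarrow> 's option" where
  "run f [] \<sigma> = Some \<sigma>"
| "run f (i # w) \<sigma> = Option.bind (f i \<sigma>) (run f w)"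

lemma run_append: "run f (v @ w) \<sigma> = Option.bind (run f v \<sigma>) (run f w)"
proof (induction v arbitrary: \<sigma>)
  case (Cons i v)
  then show ?case by (cases "f i \<sigma>") auto
qed simp

text \<open>
  The state \<open>([(a\<^sub>1, b\<^sub>1), \<dots>, (a\<^sub>k, b\<^sub>k)], l)\<close> represents
  \<open>x\<^bsup>a\<^sub>k-1\<^esup> y\<^bsup>-b\<^sub>k\<^esup> \<dots> x\<^bsup>a\<^sub>1-1\<^esup> y\<^bsup>-b\<^sub>1\<^esup> x\<^bsup>l-1\<^esup>\<close>.
\<close>

fun size_step :: "nat \<Rightarrow> nat \<Rightarrow> (nat \<times> nat) list \<times> nat \<Rightarrow> ((nat \<times> nat) list \<times> nat) option" where
  "size_step m i ([], l) = (if l + i > Suc m then None else Some ([(l + i, i)], 1))"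
| "size_step m i ((a, b) # s, l) =
     (if l + i < Suc m then Some ((l + i, i) # (a, b) # s, 1)
      else if l + i > Suc m then None
      else if l < b then Some ((a, b - l) # s, 1)
      else if l = b then Some (s, a)
      else None)"

text \<open>For \<open>run_relation\<close>: \<open>b \<le> m\<close> prevents a partial delivery
  when \<open>l = m\<close>, and \<open>2 \<le> a\<close> makes the letter \<open>m\<close> fail
  right after a pop.\<close>

definition valid_state :: "nat \<Rightarrow> (nat \<times> nat) list \<times> nat \<Rightarrow> bool" where
  "valid_state m \<sigma> \<longleftrightarrow> 1 \<le> snd \<sigma> \<and> (\<forall>(a, b)\<in>set (fst \<sigma>). 2 \<le> a \<and> b \<le> m)"

lemma valid_size_step:
  assumes "i \<in> {1..m}" "valid_state m \<sigma>" "size_step m i \<sigma> = Some \<tau>"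
  shows "valid_state m \<tau>"
  using assms by (cases "(m, i, \<sigma>)" rule: size_step.cases)
    (auto simp: valid_state_def split: if_splits)

lemma valid_run:
  "w \<in> lists {1..m} \<Longrightarrow> valid_state m \<sigma> \<Longrightarrow> run (size_step m) w \<sigma> = Some \<tau> \<Longrightarrow> valid_state m \<tau>"
proof (induction w arbitrary: \<sigma>)
  case (Cons i w)
  from Cons.prems(3) obtain \<rho> where "size_step m i \<sigma> = Some \<rho>" "run (size_step m) w \<rho> = Some \<tau>"
    by (auto simp: bind_eq_Some_conv)
  with Cons.IH[of \<rho>] Cons.prems(1,2) valid_size_step[of i m \<sigma> \<rho>] show ?case by simp
qed simp

text \<open>On a nonempty stack, both sides open the entry \<open>(l + i + 1, i)\<close> if
  \<open>l + i + 1\<close> is below \<open>Suc m\<close>, deliver \<open>l + 1\<close> leaves to the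
  top entry or fail if it is equal, and fail if it is above.\<close>

lemma run_relation:
  assumes "1 \<le> i" "i + 1 \<le> m" "valid_state m \<sigma>"
  shows "run (size_step m) [1, m, i] \<sigma> = run (size_step m) [i + 1, m] \<sigma>"
proof -
  obtain s l where \<sigma>: "\<sigma> = (s, l)" by (cases \<sigma>)
  show ?thesis
  proof (cases s)
    case Nil
    with assms \<sigma> show ?thesis
      by (auto simp: valid_state_def)
  next
    case (Cons ab s')
    obtain a b where "ab = (a, b)" by (cases ab)
    with Cons have s: "s = (a, b) # s'" by simp
    have ab: "2 \<le> a" "b \<le> m" "1 \<le> l" using assms(3) by (auto simp: valid_state_def \<sigma> s)
    \<comment> \<open>This rules out the runs in which only one side pops the top entry, since
      \<open>m\<close> is the next letter.\<close>
    have pop: "size_step m m (s', a) = None"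
      using ab(1) by (cases s') auto
    consider "l + i + 1 < Suc m" | "l + i + 1 = Suc m" | "l + i + 1 > Suc m" by linarith
    then show ?thesis
      by cases (use assms(1,2) ab pop in \<open>auto simp: \<sigma> s split: if_splits\<close>)
  qed
qed

lemma run_cong:
  "(u, v) \<in> pres_cong m \<Longrightarrow> valid_state m \<sigma> \<Longrightarrow> run (size_step m) u \<sigma> = run (size_step m) v \<sigma>"
proof (induction arbitrary: \<sigma> rule: pres_cong.induct)
  case (rel i)
  then show ?case by (intro run_relation)
next
  case (append u u' v v')
  have u: "u \<in> lists {1..m}" "u' \<in> lists {1..m}"
    using append.hyps pres_cong_in_lists by blast+
  show ?case
  proof (cases "run (size_step m) u \<sigma>")
    case None
    with append show ?thesis by (simp add: run_append)
  next
    case (Some \<tau>)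
    with valid_run[OF u(1) append.prems] append.IH append.prems show ?thesis
      by (simp add: run_append)
  qed
qed auto

text \<open>The letter 1 opens a vertex with one pending leaf and \<open>m\<close> delivers it, so
  each factor x adds one leaf.\<close>

lemma run_xpow:
  assumes "l + k \<le> Suc m" "1 \<le> l"
  shows "run (size_step m) (xpow m k) ([], l) = Some ([], l + k)"
  using assms by (induction k arbitrary: l) (auto simp: xpow_Suc)

section \<open>The parser\<close>

type_synonym parse_state = "(ptree \<times> ptree list \<times> nat) list \<times> ptree"

text \<open>
  A stack entry \<open>(u, ts, b)\<close> is a vertex with complete leftmost subtree \<open>u\<close>, further complete
  subtrees \<open>ts\<close>, and \<open>b\<close> leaves still to come.
\<close>

fun parse_step :: "nat \<Rightarrow> nat \<Rightarrow> parse_state \<Rightarrow> parse_state option" where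
  "parse_step m i ([], t) = (if leaves t + i > Suc m then None else Some ([(t, [], i)], Leaf))"
| "parse_step m i ((u, ts, b) # s, t) =
     (if leaves t + i < Suc m then Some ((t, [], i) # (u, ts, b) # s, Leaf)
      else if leaves t + i > Suc m then None
      else if leaves t < b then Some ((u, ts @ [t], b - leaves t) # s, Leaf)
      else if leaves t = b then Some (s, Node (u # ts @ [t]))
      else None)"

definition sizes :: "parse_state \<Rightarrow> (nat \<times> nat) list \<times> nat" where
  "sizes \<sigma> = (map (\<lambda>(u, ts, b). (leaves u + sum_leaves ts + b, b)) (fst \<sigma>), leaves (snd \<sigma>))"

text \<open>The guards of the parser see leaf counts only, so both automata fail together; moving
  leaves from \<open>b\<close> to \<open>ts\<close> keeps the total.\<close>

lemma sizes_parse_step: "map_option sizes (parse_step m i \<sigma>) = size_step m i (sizes \<sigma>)"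
  by (cases "(m, i, \<sigma>)" rule: parse_step.cases) (auto simp: sizes_def)

lemma sizes_run: "map_option sizes (run (parse_step m) w \<sigma>) = run (size_step m) w (sizes \<sigma>)"
proof (induction w arbitrary: \<sigma>)
  case (Cons i w)
  then show ?case
    by (cases "parse_step m i \<sigma>") (simp_all flip: sizes_parse_step)
qed simp

text \<open>The letter after \<open>u\<close> includes the \<open>b\<close> pending leaves: it is
  the label of \<open>u\<close> once its parent is complete.\<close>

definition entry_word :: "nat \<Rightarrow> ptree \<times> ptree list \<times> nat \<Rightarrow> nat list" where
  "entry_word m = (\<lambda>(u, ts, b). body m u @ [sum_leaves ts + b] @
     concat (map (\<lambda>t. body m t @ [Suc m - leaves t]) ts))"

definition state_word :: "nat \<Rightarrow> parse_state \<Rightarrow> nat list" where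
  "state_word m \<sigma> = concat (map (entry_word m) (rev (fst \<sigma>))) @ body m (snd \<sigma>)"

definition schroeder_state :: "parse_state \<Rightarrow> bool" where
  "schroeder_state \<sigma> \<longleftrightarrow>
     schroeder (snd \<sigma>) \<and> (\<forall>e\<in>set (fst \<sigma>). \<forall>t\<in>insert (fst e) (set (fst (snd e))). schroeder t)"

lemma state_word_parse_step:
  assumes "parse_step m i \<sigma> = Some \<tau>"
  shows "state_word m \<tau> = state_word m \<sigma> @ [i]"
proof (cases "(m, i, \<sigma>)" rule: parse_step.cases)
  case (1 m' i' t)
  with assms show ?thesis by (auto simp: state_word_def entry_word_def split: if_splits)
next
  case (2 m' i' u ts b s t)
  \<comment> \<open>A letter that completes a non-leftmost subtree is forced to be the root label of
    that subtree.\<close>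
  have "i = Suc m - leaves t" if "leaves t + i = Suc m" using that by simp
  with assms 2 show ?thesis by (auto simp: state_word_def entry_word_def split: if_splits)
qed

lemma schroeder_parse_step:
  "parse_step m i \<sigma> = Some \<tau> \<Longrightarrow> schroeder_state \<sigma> \<Longrightarrow> schroeder_state \<tau>"
  by (cases "(m, i, \<sigma>)" rule: parse_step.cases) (auto simp: schroeder_state_def split: if_splits)

lemma run_parse_sound:
  "run (parse_step m) w \<sigma> = Some \<tau> \<Longrightarrow> schroeder_state \<sigma> \<Longrightarrow>
     state_word m \<tau> = state_word m \<sigma> @ w \<and> schroeder_state \<tau>"
proof (induction w arbitrary: \<sigma>)
  case (Cons i w)
  from Cons.prems(1) obtain \<rho> where "parse_step m i \<sigma> = Some \<rho>" "run (parse_step m) w \<rho> = Some \<tau>"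
    by (auto simp: bind_eq_Some_conv)
  with Cons.IH[of \<rho>] Cons.prems(2) state_word_parse_step[of m i \<sigma> \<rho>] schroeder_parse_step[of m i \<sigma> \<rho>]
  show ?case by simp
qed simp

text \<open>The root of the whole tree is the only vertex that may have more than \<open>m\<close> leaves below it.\<close>

lemma run_parse_body:
  assumes "schroeder t" "leaves t \<le> (if s = [] then Suc m else m)"
  shows "run (parse_step m) (body m t) (s, Leaf) = Some (s, t)"
  using assms
proof (induction t arbitrary: s rule: schroeder_induct)
  case Leaf
  show ?case by simp
next
  case (Node u us)
  let ?rest = "\<lambda>us. concat (map (\<lambda>t. body m t @ [Suc m - leaves t]) us)"
  have u: "1 \<le> leaves u" using Node.hyps(2) by (rule leaves_pos)
  \<comment> \<open>Here \<open>ts\<close> is already read and \<open>vs\<close> is pending. The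
    last subtree of \<open>vs\<close> closes the vertex; earlier ones do not, as the rest still has
    leaves.\<close>
  have "vs \<noteq> [] \<Longrightarrow> ts @ vs = us \<Longrightarrow>
      run (parse_step m) (?rest vs) ((u, ts, sum_leaves vs) # s, Leaf) = Some (s, Node (u # us))" for ts vs
  proof (induction vs arbitrary: ts)
    case (Cons v vs)
    have v: "v \<in> set us" using Cons.prems by auto
    have le: "leaves v \<le> m"
      using leaves_le_sum_leaves[OF v] Node.prems u by (auto split: if_splits)
    have pos: "0 < leaves v" using leaves_pos[OF Node.hyps(3)[OF v]] by simp
    have read: "run (parse_step m) (body m v) ((u, ts, sum_leaves (v # vs)) # s, Leaf) =
        Some ((u, ts, sum_leaves (v # vs)) # s, v)"
      using Node.IH(2)[OF v] le by simp
    show ?case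
    proof (cases "vs = []")
      case True
      with read Cons.prems le show ?thesis by (simp add: run_append)
    next
      case False
      have "\<And>t. t \<in> set vs \<Longrightarrow> schroeder t"
        using Node.hyps(3) Cons.prems by auto
      then have "1 \<le> sum_leaves vs"
        using False by (intro sum_leaves_pos)
      with read le Cons.IH[of "ts @ [v]"] False Cons.prems show ?thesis
        by (simp add: run_append)
    qed
  qed simp
  from this[of us "[]"]
  have rest: "run (parse_step m) (?rest us) ((u, [], sum_leaves us) # s, Leaf) = Some (s, Node (u # us))"
    using Node.hyps(1) by simp
  have "run (parse_step m) (body m u) (s, Leaf) = Some (s, u)"
    using Node.IH(1)[of s] Node.prems by (auto split: if_splits)
  moreover have "parse_step m (sum_leaves us) (s, u) = Some ((u, [], sum_leaves us) # s, Leaf)"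
    using Node.prems by (cases s) auto
  ultimately show ?case
    using rest by (simp add: run_append)
qed

text \<open>The parser recovers the tree from its word.\<close>

lemma inj_on_body: "inj_on (body m) (schroeder_trees (Suc m))"
proof (rule inj_onI)
  fix t t'
  assume t: "t \<in> schroeder_trees (Suc m)" and t': "t' \<in> schroeder_trees (Suc m)"
    and eq: "body m t = body m t'"
  have parse: "run (parse_step m) (body m u) ([], Leaf) = Some ([], u)"
    if "u \<in> schroeder_trees (Suc m)" for u
    using that by (intro run_parse_body) (simp_all add: schroeder_trees_def)
  from parse[OF t] parse[OF t'] show "t = t'"
    unfolding eq by simp
qed

text \<open>Success depends on sizes only, and there \<open>w\<close> runs like
  \<open>xpow m m\<close>. The empty final stack means that the parser ends with a single complete
  tree, whose word is \<open>w\<close>.\<close>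

lemma body_surj:
  assumes "(w, xpow m m) \<in> pres_cong m"
  shows "\<exists>t\<in>schroeder_trees (Suc m). body m t = w"
proof -
  have init: "sizes ([], Leaf) = ([], 1)" "schroeder_state ([], Leaf)"
    by (simp_all add: sizes_def schroeder_state_def)
  have "run (size_step m) w ([], 1) = run (size_step m) (xpow m m) ([], 1)"
    by (rule run_cong[OF assms]) (simp add: valid_state_def)
  also have "\<dots> = Some ([], 1 + m)"
    by (rule run_xpow) simp_all
  finally have "map_option sizes (run (parse_step m) w ([], Leaf)) = Some ([], 1 + m)"
    by (simp only: sizes_run init)
  then obtain \<tau> where \<tau>: "run (parse_step m) w ([], Leaf) = Some \<tau>" "sizes \<tau> = ([], 1 + m)"
    by (auto simp only: map_option_eq_Some)
  obtain t where t: "\<tau> = ([], t)" "leaves t = Suc m"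
    using \<tau>(2) by (cases \<tau>) (simp add: sizes_def)
  from run_parse_sound[OF \<tau>(1) init(2)] have "schroeder t" "body m t = w"
    unfolding t(1) by (simp_all add: schroeder_state_def state_word_def)
  with t(2) show ?thesis by (auto simp: schroeder_trees_def)
qed

lemma image_body: "body m ` schroeder_trees (Suc m) = {w. (w, xpow m m) \<in> pres_cong m}"
proof (intro equalityI subsetI)
  fix w assume "w \<in> body m ` schroeder_trees (Suc m)"
  then obtain t where "schroeder t" "leaves t = Suc m" "w = body m t"
    by (auto simp: schroeder_trees_def)
  with body_cong[of t m] show "w \<in> {w. (w, xpow m m) \<in> pres_cong m}"
    by simp
qed (use body_surj in force)

section \<open>Words for the power of \<open>\<rho>\<^sub>m\<close>\<close>

lemma one_rho_monoid: "\<one>\<^bsub>rho_monoid m\<^esub> = pres_cong m `` {[]}"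
  by (simp add: rho_monoid_def)

lemma word_prod_eq: "w \<in> lists {1..m} \<Longrightarrow> word_prod m w = pres_cong m `` {w}"
proof (induction w)
  case Nil
  show ?case by (simp add: word_prod_def one_rho_monoid)
next
  case (Cons i w)
  then have "word_prod m (i # w) = pres_cong m `` {[i]} \<otimes>\<^bsub>rho_monoid m\<^esub> pres_cong m `` {w}"
    by (auto simp: word_prod_def rho_def)
  also have "\<dots> = pres_cong m `` {[i] @ w}"
    using Cons.prems by (intro mult_class_rho_monoid) auto
  finally show ?case by simp
qed

lemma rho_pow: "1 \<le> m \<Longrightarrow> rho m m [^]\<^bsub>rho_monoid m\<^esub> (k :: nat) = pres_cong m `` {replicate k m}"
proof (induction k)
  case 0
  show ?case by (simp add: one_rho_monoid)
next
  case (Suc k)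
  then have "replicate k m \<in> lists {1..m}" "[m] \<in> lists {1..m}"
    by auto
  with Suc show ?case
    using mult_class_rho_monoid[of "replicate k m" m "[m]"]
    by (simp add: rho_def replicate_append_same)
qed

lemma rho_pow_Suc: "rho m m [^]\<^bsub>rho_monoid m\<^esub> Suc m = pres_cong m `` {xpow m m}"
proof (cases "m = 0")
  \<comment> \<open>Here \<open>rho 0 0\<close> is the identity by convention, and
    \<open>xpow 0 0\<close> is empty.\<close>
  case True
  interpret monoid "rho_monoid 0" by (rule monoid_rho_monoid)
  show ?thesis using True by (simp add: rho_def one_rho_monoid[symmetric])
next
  case False
  then have "(replicate (Suc m) m, xpow m m) \<in> pres_cong m"
    using letter_xpow[of m m] by simp
  then have "pres_cong m `` {replicate (Suc m) m} = pres_cong m `` {xpow m m}"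
    by (rule equiv_class_eq[OF equiv_pres_cong])
  with False rho_pow[of m "Suc m"] show ?thesis by simp
qed

lemma words_for_class:
  assumes "v \<in> lists {1..m}"
  shows "words_for m (pres_cong m `` {v}) = {w. (w, v) \<in> pres_cong m}"
proof -
  have "word_prod m w = pres_cong m `` {v} \<longleftrightarrow> (w, v) \<in> pres_cong m" if "w \<in> lists {1..m}" for w
    using that assms by (simp add: word_prod_eq eq_equiv_class_iff[OF equiv_pres_cong])
  then show ?thesis
    unfolding words_for_def by (blast dest: pres_cong_in_lists)
qed

theorem theorem3p12:
  fixes n m :: nat
  assumes "n \<ge> 1" and "m = n - 1"
  shows "bij_betw (Phi m) (schroeder_trees n)
           (words_for (n - 1) (rho (n - 1) (n - 1) [^]\<^bsub>rho_monoid (n - 1)\<^esub> n))"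
proof -
  have n: "n = Suc m" using assms by simp
  have "xpow m m \<in> lists {1..m}"
    using xpow_in_lists by (cases "m = 0") auto
  then have words: "words_for m (rho m m [^]\<^bsub>rho_monoid m\<^esub> n) = body m ` schroeder_trees n"
    unfolding n rho_pow_Suc image_body by (rule words_for_class)
  have "bij_betw (body m) (schroeder_trees n) (words_for m (rho m m [^]\<^bsub>rho_monoid m\<^esub> n))"
    unfolding words unfolding n by (rule inj_on_imp_bij_betw[OF inj_on_body])
  moreover have "Phi m T = body m T" if "T \<in> schroeder_trees n" for T
    using that by (intro Phi_eq_body) (simp_all add: schroeder_trees_def n)
  ultimately have "bij_betw (Phi m) (schroeder_trees n) (words_for m (rho m m [^]\<^bsub>rho_monoid m\<^esub> n))"
    by (simp cong: bij_betw_cong)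
  with assms(2) show ?thesis by simp
qed

end
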